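(* Let $F$ be the PCA with alphabet $\{0,1\}$, neighborhood $\{0,1\}$ and parameters $\theta_{00},\theta_{01},\theta_{10},\theta_{11}$, and let $p\in(0,1)$. The Bernoulli product measure $\mu_p$ is an invariant measure of $F$ (that is, $\mu_pF=\mu_p$) if and only if one of the following two conditions is satisfied: \begin{itemize} \item[(i)] $(1-p)\theta_{00}+p\,\theta_{01}=(1-p)\theta_{10}+p\,\theta_{11}=p$; \item[(ii)] $(1-p)\theta_{00}+p\,\theta_{10}=(1-p)\theta_{01}+p\,\theta_{11}=p$. \end{itemize} In particular, a PCA (with alphabet $\{0,1\}$ and neighborhood $\{0,1\}$) has a (non-trivial) Bernoulli product invariant measure if and only if its parameters satisfy $$\theta_{00}(1-\theta_{11})=\theta_{10}(1-\theta_{01})\quad\text{or}\quad \theta_{00}(1-\theta_{11})=\theta_{01}(1-\theta_{10}).$$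
   Context: A probabilistic cellular automaton (PCA) with alphabet $\{0,1\}$ and neighborhood $\{0,1\}$ is determined by four parameters $\theta_{xy}\in[0,1]$, $x,y\in\{0,1\}$: all cells, indexed by $\mathbb Z$, are updated synchronously, and the new value of cell $k\in\mathbb Z$ equals $1$ with probability $\theta_{xy}$ (and $0$ with probability $1-\theta_{xy}$) when the current values of cells $k$ and $k+1$ are $x$ and $y$, independently for different cells. Write $\theta^1_{xy}=\theta_{xy}$ and $\theta^0_{xy}=1-\theta_{xy}$. For a probability measure $\mu$ on $\{0,1\}^{\mathbb Z}$, $\mu F$ is the law of the configuration obtained by applying one step of the PCA to a configuration of law $\mu$; explicitly, on cylinders on consecutive cells, $\mu F[y_a\cdots y_b]=\sum_{x_a\cdots x_{b+1}}\mu[x_a\cdots x_{b+1}]\prod_{k=a}^b\theta_{x_kx_{k+1}}^{y_k}$. For $p\in[0,1]$, $\mu_p$ denotes the Bernoulli product measure on $\{0,1\}^{\mathbb Z}$ under which the coordinates are independent and each equals $1$ with probability $p$; it is called non-trivial when $p\in(0,1)$.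
   Formalization: The final equivalence excludes parameters where exactly one of θ00=θ10=0, θ01=θ11=1 holds, or exactly one of θ00=θ01=0, θ10=θ11=1: there the condition holds but no p in (0,1) works. For all parameters, "only if" is given for p in (0,1) and "if" for p in [0,1]. *)

theory Defs
  imports "HOL-Probability.Probability"
begin

text \<open>The alphabet is \<^typ>\<open>bool\<close>, with \<^const>\<open>False\<close> for 0 and \<^const>\<open>True\<close> for 1.\<close>

type_synonym config = "int \<Rightarrow> bool"

definition config_space :: "config measure" where
  "config_space = PiM UNIV (\<lambda>_. count_space UNIV)"

definition bernoulli_product :: "real \<Rightarrow> config measure" where
  "bernoulli_product p = PiM UNIV (\<lambda>_. measure_pmf (bernoulli_pmf p))"

text \<open>\<open>\<theta> x y\<close> is the probability that a cell takes the value 1 when its own current value is \<open>x\<close>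
  and that of its right neighbour is \<open>y\<close>; \<open>pca_kernel \<theta> x\<close> is the law of the configuration
  following \<open>x\<close>, and \<open>pca_step \<theta> \<mu>\<close> is \<open>\<mu>F\<close>.\<close>

definition pca_kernel :: "(bool \<Rightarrow> bool \<Rightarrow> real) \<Rightarrow> config \<Rightarrow> config measure" where
  "pca_kernel \<theta> x = PiM UNIV (\<lambda>k. measure_pmf (bernoulli_pmf (\<theta> (x k) (x (k + 1)))))"

definition pca_step :: "(bool \<Rightarrow> bool \<Rightarrow> real) \<Rightarrow> config measure \<Rightarrow> config measure" where
  "pca_step \<theta> \<mu> = \<mu> \<bind> pca_kernel \<theta>"

definition pca_invariant :: "(bool \<Rightarrow> bool \<Rightarrow> real) \<Rightarrow> config measure \<Rightarrow> bool" where
  "pca_invariant \<theta> \<mu> \<longleftrightarrow> pca_step \<theta> \<mu> = \<mu>"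

definition local_prob :: "(bool \<Rightarrow> bool \<Rightarrow> real) \<Rightarrow> bool \<Rightarrow> bool \<Rightarrow> bool \<Rightarrow> real" where
  "local_prob \<theta> x y z = (if z then \<theta> x y else 1 - \<theta> x y)"

definition cylinder :: "int set \<Rightarrow> config \<Rightarrow> config set" where
  "cylinder J y = {x. \<forall>k\<in>J. x k = y k}"

lemma space_config_space [simp]: "space config_space = UNIV"
  by (auto simp: config_space_def space_PiM)

lemma sets_bernoulli_product [measurable_cong]: "sets (bernoulli_product p) = sets config_space"
  unfolding bernoulli_product_def config_space_def by (intro sets_PiM_cong) auto

lemma sets_pca_kernel [measurable_cong]: "sets (pca_kernel \<theta> x) = sets config_space"
  unfolding pca_kernel_def config_space_def by (intro sets_PiM_cong) auto

lemma prob_space_bernoulli_product: "prob_space (bernoulli_product p)"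
  unfolding bernoulli_product_def by (intro prob_space_PiM measure_pmf.prob_space_axioms)

lemma prob_space_pca_kernel: "prob_space (pca_kernel \<theta> x)"
  unfolding pca_kernel_def by (intro prob_space_PiM measure_pmf.prob_space_axioms)

lemma measurable_coord [measurable]: "(\<lambda>x. x k) \<in> config_space \<rightarrow>\<^sub>M count_space UNIV"
  unfolding config_space_def by measurable

lemma cylinder_sets: "finite J \<Longrightarrow> cylinder J y \<in> sets config_space"
proof -
  assume "finite J"
  then have "{x \<in> space config_space. \<forall>k\<in>J. x k = y k} \<in> sets config_space"
    by measurable
  then show ?thesis by (simp add: cylinder_def)
qed

lemma emeasure_pca_kernel_emb:
  assumes "finite J"
  shows "emeasure (pca_kernel \<theta> x) (prod_emb UNIV (\<lambda>_. count_space UNIV) J (Pi\<^sub>E J A)) =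
    (\<Prod>k\<in>J. emeasure (measure_pmf (bernoulli_pmf (\<theta> (x k) (x (k + 1))))) (A k))"
proof -
  have "prod_emb UNIV (\<lambda>_. count_space UNIV) J (Pi\<^sub>E J A) =
      prod_emb UNIV (\<lambda>k. measure_pmf (bernoulli_pmf (\<theta> (x k) (x (k + 1))))) J (Pi\<^sub>E J A)"
    by (simp add: prod_emb_def)
  with assms show ?thesis
    unfolding pca_kernel_def by (simp add: emeasure_PiM_emb measure_pmf.prob_space_axioms)
qed

lemma pca_kernel_measurable: "pca_kernel \<theta> \<in> config_space \<rightarrow>\<^sub>M prob_algebra config_space"
proof (rule measurable_prob_algebra_generated)
  show "sets config_space = sigma_sets (\<Pi>\<^sub>E i\<in>UNIV. space (count_space UNIV))
      (prod_algebra UNIV (\<lambda>_. count_space UNIV))"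
    unfolding config_space_def by (rule sets_PiM)
  show "Int_stable (prod_algebra UNIV (\<lambda>_::int. count_space (UNIV :: bool set)))"
    by (rule Int_stable_prod_algebra)
  show "prod_algebra UNIV (\<lambda>_. count_space UNIV) \<subseteq>
      Pow (\<Pi>\<^sub>E i\<in>(UNIV :: int set). space (count_space (UNIV :: bool set)))"
    by (rule prod_algebra_sets_into_space)
next
  fix A :: "config set" assume "A \<in> prod_algebra UNIV (\<lambda>_. count_space UNIV)"
  then obtain J X where A: "A = prod_emb UNIV (\<lambda>_. count_space UNIV) J (Pi\<^sub>E J X)"
    and J: "finite J"
    by (rule prod_algebraE) blast
  have "(\<lambda>x. emeasure (measure_pmf (bernoulli_pmf (\<theta> (x k) (x (k + 1))))) B)
      \<in> borel_measurable config_space" for k B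
    by (rule measurable_compose_countable'[where I = UNIV, OF _ measurable_coord[of k]],
        rule measurable_compose_countable'[where I = UNIV, OF _ measurable_coord[of "k + 1"]])
      auto
  then show "(\<lambda>x. emeasure (pca_kernel \<theta> x) A) \<in> borel_measurable config_space"
    unfolding A emeasure_pca_kernel_emb[OF J] by (intro borel_measurable_prod_ennreal) auto
qed (simp_all add: prob_space_pca_kernel sets_pca_kernel)

lemma measure_pca_kernel_cylinder:
  assumes \<theta>: "\<And>x y. \<theta> x y \<in> {0..1}" and J: "finite J"
  shows "measure (pca_kernel \<theta> x) (cylinder J y) = (\<Prod>k\<in>J. local_prob \<theta> (x k) (x (k + 1)) (y k))"
proof -
  have cyl: "cylinder J y = prod_emb UNIV (\<lambda>_. count_space UNIV) J (Pi\<^sub>E J (\<lambda>k. {y k}))"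
    by (auto simp: cylinder_def prod_emb_def PiE_iff space_PiM extensional_def restrict_def)
  have "emeasure (measure_pmf (bernoulli_pmf (\<theta> a b))) {c} = ennreal (local_prob \<theta> a b c)" for a b c
    using \<theta>[of a b] by (cases c) (simp_all add: emeasure_pmf_single local_prob_def)
  moreover have "0 \<le> local_prob \<theta> a b c" for a b c
    using \<theta>[of a b] by (simp add: local_prob_def)
  ultimately show ?thesis
    unfolding measure_def cyl emeasure_pca_kernel_emb[OF J]
    by (simp add: prod_ennreal prod_nonneg)
qed

text \<open>Sanity check: \<^const>\<open>pca_step\<close> acts on cylinders over consecutive cells by the usual formula.\<close>

lemma measure_pca_step_cylinder:
  assumes \<theta>: "\<And>x y. \<theta> x y \<in> {0..1}"
    and \<mu>: "prob_space \<mu>" "sets \<mu> = sets config_space"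
  shows "measure (pca_step \<theta> \<mu>) (cylinder {a..b} y) =
    (\<Sum>x \<in> PiE {a..b+1} (\<lambda>_. UNIV). measure \<mu> (cylinder {a..b+1} x) *
       (\<Prod>k=a..b. local_prob \<theta> (x k) (x (k + 1)) (y k)))"
proof -
  interpret \<mu>: prob_space \<mu> by fact
  let ?I = "PiE {a..b+1} (\<lambda>_. UNIV :: bool set)"
  have [simp]: "finite ?I" by (intro finite_PiE) auto
  have sp: "space \<mu> = UNIV" using sets_eq_imp_space_eq[OF \<mu>(2)] by simp
  have K: "pca_kernel \<theta> \<in> \<mu> \<rightarrow>\<^sub>M subprob_algebra config_space"
    using measurable_prob_algebraD[OF pca_kernel_measurable] \<mu>(2)
    by (simp cong: measurable_cong_sets)
  have dec: "measure (pca_kernel \<theta> z) (cylinder {a..b} y) =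
    (\<Sum>x\<in>?I. indicator (cylinder {a..b+1} x) z * (\<Prod>k=a..b. local_prob \<theta> (x k) (x (k + 1)) (y k)))"
    for z
  proof -
    have iff: "z \<in> cylinder {a..b+1} x \<longleftrightarrow> x = restrict z {a..b+1}" if "x \<in> ?I" for x
      using that by (fastforce simp: cylinder_def PiE_iff extensional_def fun_eq_iff restrict_def)
    have "(\<Sum>x\<in>?I. indicator (cylinder {a..b+1} x) z * (\<Prod>k=a..b. local_prob \<theta> (x k) (x (k + 1)) (y k)))
      = (\<Sum>x\<in>?I. if x = restrict z {a..b+1}
           then \<Prod>k=a..b. local_prob \<theta> (x k) (x (k + 1)) (y k) else 0)"
      by (intro sum.cong) (auto simp: indicator_def iff)
    also have "\<dots> = (\<Prod>k=a..b. local_prob \<theta> (z k) (z (k + 1)) (y k))"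
      by (subst sum.delta) (auto intro!: prod.cong)
    finally show ?thesis by (simp add: measure_pca_kernel_cylinder[OF \<theta>])
  qed
  have "measure (pca_step \<theta> \<mu>) (cylinder {a..b} y) =
      (\<integral>z. measure (pca_kernel \<theta> z) (cylinder {a..b} y) \<partial>\<mu>)"
    unfolding pca_step_def by (intro \<mu>.measure_bind[OF K] cylinder_sets) auto
  also have "\<dots> = (\<Sum>x\<in>?I. measure \<mu> (cylinder {a..b+1} x) *
       (\<Prod>k=a..b. local_prob \<theta> (x k) (x (k + 1)) (y k)))"
    unfolding dec using \<mu>(2)
    by (subst Bochner_Integration.integral_sum)
       (auto simp: sp cylinder_sets \<mu>.emeasure_finite less_top[symmetric])
  finally show ?thesis .
qed

text \<open>At boundary parameters, the algebraic condition for the existence of a non-trivial Bernoulli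
  invariant measure is not sufficient: if for instance \<open>\<theta>\<^sub>0\<^sub>0 = \<theta>\<^sub>1\<^sub>0 = 0\<close> and
  \<open>\<theta>\<^sub>0\<^sub>1 = \<theta>\<^sub>1\<^sub>1 = 1/2\<close>, it holds, but each step halves the density of 1s, so only \<open>p = 0\<close>
  gives an invariant measure. It fails to be sufficient exactly when one of the two neighbours
  (the right one in the first line below, the left one in the second) forces the updated cell to
  copy it for one of its values but not for the other.\<close>

definition degenerate :: "(bool \<Rightarrow> bool \<Rightarrow> real) \<Rightarrow> bool" where
  "degenerate \<theta> \<longleftrightarrow>
     (\<theta> False False = 0 \<and> \<theta> True False = 0) \<noteq> (\<theta> False True = 1 \<and> \<theta> True True = 1) \<or>
     (\<theta> False False = 0 \<and> \<theta> False True = 0) \<noteq> (\<theta> True False = 1 \<and> \<theta> True True = 1)"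

lemma degenerate_satisfies_condition:
  assumes "degenerate \<theta>"
  shows "\<theta> False False * (1 - \<theta> True True) = \<theta> True False * (1 - \<theta> False True) \<or>
    \<theta> False False * (1 - \<theta> True True) = \<theta> False True * (1 - \<theta> True False)"
  using assms unfolding degenerate_def by auto

lemma degenerate_no_nontrivial_solution:
  assumes "degenerate \<theta>" and p: "0 < p" "p < 1"
  shows "\<not> ((1 - p) * \<theta> False False + p * \<theta> False True = p \<and>
              (1 - p) * \<theta> True False + p * \<theta> True True = p)"
    and "\<not> ((1 - p) * \<theta> False False + p * \<theta> True False = p \<and>
              (1 - p) * \<theta> False True + p * \<theta> True True = p)"
proof -
  have "u = 0 \<longleftrightarrow> v = 1" "\<not> (u = 0 \<and> v = 0)" "\<not> (u = 1 \<and> v = 1)"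
    if "(1 - p) * u + p * v = p" for u v
    using that p by auto
  with assms(1) show "\<not> ((1 - p) * \<theta> False False + p * \<theta> False True = p \<and>
      (1 - p) * \<theta> True False + p * \<theta> True True = p)"
    and "\<not> ((1 - p) * \<theta> False False + p * \<theta> True False = p \<and>
      (1 - p) * \<theta> False True + p * \<theta> True True = p)"
    unfolding degenerate_def by metis+
qed

end

theory Submission
  imports Defs
begin

text \<open>
  Write \<open>w\<close> for the Bernoulli weights \<open>w(1) = p\<close>, \<open>w(0) = 1 - p\<close>. The probability under
  \<open>\<mu>\<^sub>pF\<close> of a word \<open>y\<close> is the \<open>\<mu>\<^sub>p\<close>-expectation of a product of factors, each of which involves
  two neighbouring cells. It can therefore be evaluated by integrating out the rightmost cell
  again and again, that is, by iterating a transfer operator on functions of a single cell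
  (\<open>transfer_expectation_Suc\<close>).

  Sufficiency. Condition (i) says that, once the left cell is known, averaging over the right one
  already gives the law \<open>w\<close>. Integrating out the rightmost cell then produces the
  scalar \<open>w(y)\<close>, so that \<open>y\<close> has \<open>\<mu>\<^sub>pF\<close>-probability \<open>\<Prod>\<^sub>k w(y\<^sub>k)\<close>. Condition (ii) is the mirror
  image: the word read so far is independent of the rightmost cell, which still has law \<open>w\<close>.
  A measure is determined by the probabilities of words, so \<open>\<mu>\<^sub>p\<close> is invariant. This works for
  all \<open>p \<in> [0,1]\<close>.

  Necessity. Only the words 1 and 11 matter. Let \<open>f(s)\<close> and \<open>g(s)\<close> be the probabilities that
  a new 1 is produced when the right, respectively the left, of its two parents is \<open>s\<close> and the
  other one has law \<open>w\<close>. The word 1 gives \<open>E f = E g = p\<close> and the word 11 gives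
  \<open>E (f g) = p\<^sup>2\<close>, so \<open>f\<close> and \<open>g\<close> are uncorrelated under \<open>w\<close>. On a two-point space the covariance
  is \<open>p (1 - p) (f(1) - f(0)) (g(1) - g(0))\<close>, so one of them is constant, and its constant value
  is its mean \<open>p\<close>. This is (ii) for \<open>f\<close> and (i) for \<open>g\<close>.

  Existence of \<open>p\<close> (\<open>common_ratio_of_parallel\<close>). Condition (i) reads
  \<open>(1 - p) (\<theta>\<^sub>0\<^sub>0, \<theta>\<^sub>1\<^sub>0) = p (1 - \<theta>\<^sub>0\<^sub>1, 1 - \<theta>\<^sub>1\<^sub>1)\<close>, and the algebraic identity says that the two
  nonnegative vectors here are parallel. So a solution \<open>p \<in> [0,1]\<close> exists, and it can be taken
  inside \<open>(0,1)\<close> unless exactly one of the vectors vanishes. Exchanging the neighbours gives the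
  statement for (ii).
\<close>

section \<open>Words determine a measure\<close>

text \<open>A product set that constrains finitely many cells is a finite disjoint union of cylinders over
  any interval of cells containing them, and such product sets determine the measure.\<close>

lemma measure_eqI_cylinders:
  assumes \<mu>: "finite_measure \<mu>" "sets \<mu> = sets config_space"
    and \<nu>: "finite_measure \<nu>" "sets \<nu> = sets config_space"
    and eq: "\<And>a b y. measure \<mu> (cylinder {a..b} y) = measure \<nu> (cylinder {a..b} y)"
  shows "\<mu> = \<nu>"
proof (rule measure_eqI_PiM_infinite)
  show "sets \<mu> = sets (PiM UNIV (\<lambda>_. count_space UNIV))"
    and "sets \<nu> = sets (PiM UNIV (\<lambda>_. count_space UNIV))"
    using \<mu>(2) \<nu>(2) by (simp_all add: config_space_def)
  show "finite_measure \<mu>" by fact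
next
  fix A :: "int \<Rightarrow> bool set" and J :: "int set"
  assume J: "finite J"
  obtain a b where ab: "J \<subseteq> {a..b}"
  proof (cases "J = {}")
    case False
    then have "J \<subseteq> {Min J..Max J}" using J by auto
    then show thesis by (rule that)
  qed (use that[of 0 0] in auto)
  let ?I = "{x \<in> PiE {a..b} (\<lambda>_. UNIV). \<forall>k\<in>J. x k \<in> A k}"
  have fin: "finite ?I"
    by (rule finite_subset[of _ "PiE {a..b} (\<lambda>_. UNIV)"]) (auto intro!: finite_PiE)
  have X: "prod_emb UNIV (\<lambda>_. count_space UNIV) J (Pi\<^sub>E J A) = (\<Union>x\<in>?I. cylinder {a..b} x)"
    (is "?X = _")
  proof (intro set_eqI iffI)
    fix z assume "z \<in> ?X"
    then have "\<forall>k\<in>J. z k \<in> A k" by (simp add: prod_emb_def PiE_iff)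
    then have "restrict z {a..b} \<in> ?I" using ab by (simp add: subset_iff)
    moreover have "z \<in> cylinder {a..b} (restrict z {a..b})" by (simp add: cylinder_def)
    ultimately show "z \<in> (\<Union>x\<in>?I. cylinder {a..b} x)" by blast
  next
    fix z assume "z \<in> (\<Union>x\<in>?I. cylinder {a..b} x)"
    then have "\<forall>k\<in>J. z k \<in> A k" using ab by (fastforce simp: cylinder_def)
    then show "z \<in> ?X" by (simp add: prod_emb_def PiE_iff)
  qed
  have disj: "disjoint_family_on (cylinder {a..b}) ?I"
  proof (unfold disjoint_family_on_def, intro ballI impI)
    fix x x' assume xx: "x \<in> ?I" "x' \<in> ?I" "x \<noteq> x'"
    then have "x \<in> PiE {a..b} (\<lambda>_. UNIV)" "x' \<in> PiE {a..b} (\<lambda>_. UNIV)" by simp_all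
    from PiE_ext[OF this] xx(3) obtain k where k: "k \<in> {a..b}" "x k \<noteq> x' k" by blast
    have False if "z \<in> cylinder {a..b} x" "z \<in> cylinder {a..b} x'" for z
    proof -
      have "z k = x k" "z k = x' k" using that k(1) unfolding cylinder_def by blast+
      then show False using k(2) by simp
    qed
    then show "cylinder {a..b} x \<inter> cylinder {a..b} x' = {}" by blast
  qed
  have meas: "measure M ?X = (\<Sum>x\<in>?I. measure M (cylinder {a..b} x))"
    if "finite_measure M" "sets M = sets config_space" for M
    unfolding X using that disj fin
    by (intro finite_measure.finite_measure_finite_Union) (auto simp: cylinder_sets)
  have "measure \<mu> ?X = measure \<nu> ?X"
    by (simp add: meas[OF \<mu>] meas[OF \<nu>] eq)
  then show "emeasure \<mu> ?X = emeasure \<nu> ?X"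
    using finite_measure.emeasure_eq_measure[OF \<mu>(1)] finite_measure.emeasure_eq_measure[OF \<nu>(1)]
    by simp
qed

definition bernoulli_weight :: "real \<Rightarrow> bool \<Rightarrow> real" where
  "bernoulli_weight p z = (if z then p else 1 - p)"

text \<open>A Bernoulli product measure is the law after one step of the PCA that ignores its
  neighbourhood, so the formula for the kernel applies.\<close>

lemma measure_bernoulli_product_cylinder:
  assumes "p \<in> {0..1}" "finite J"
  shows "measure (bernoulli_product p) (cylinder J y) = (\<Prod>k\<in>J. bernoulli_weight p (y k))"
proof -
  have "bernoulli_product p = pca_kernel (\<lambda>_ _. p) undefined"
    by (simp add: bernoulli_product_def pca_kernel_def)
  then show ?thesis
    using measure_pca_kernel_cylinder[of "\<lambda>_ _. p" J undefined y] assms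
    by (simp add: local_prob_def bernoulli_weight_def)
qed

section \<open>The transfer operator\<close>

text \<open>This is the \<open>\<mu>\<^sub>p\<close>-expectation of \<open>h\<close> at the rightmost cell times the
  probability that the \<open>n\<close> cells from \<open>a\<close> on are updated to \<open>y\<close>. The function \<open>h\<close> is carried along
  because integrating out one cell leaves a function of the next one.\<close>

definition transfer_expectation ::
  "(bool \<Rightarrow> bool \<Rightarrow> real) \<Rightarrow> real \<Rightarrow> config \<Rightarrow> int \<Rightarrow> nat \<Rightarrow> (bool \<Rightarrow> real) \<Rightarrow> real" where
  "transfer_expectation \<theta> p y a n h =
    (\<Sum>x \<in> PiE {a..a + int n} (\<lambda>_. UNIV). (\<Prod>k=a..a + int n. bernoulli_weight p (x k)) *
       (\<Prod>k=a..<a + int n. local_prob \<theta> (x k) (x (k + 1)) (y k)) * h (x (a + int n)))"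

lemma sum_PiE_insert:
  fixes F :: "('i \<Rightarrow> 'b) \<Rightarrow> 'c::comm_monoid_add"
  assumes "i \<notin> I"
  shows "(\<Sum>x \<in> PiE (insert i I) B. F x) = (\<Sum>x \<in> PiE I B. \<Sum>s \<in> B i. F (x(i := s)))"
proof -
  have "(\<Sum>x \<in> PiE (insert i I) B. F x) = (\<Sum>(s, x) \<in> B i \<times> PiE I B. F (x(i := s)))"
    unfolding PiE_insert_eq using inj_combinator[OF assms, of B]
    by (subst sum.reindex) (auto simp: case_prod_unfold)
  also have "\<dots> = (\<Sum>s \<in> B i. \<Sum>x \<in> PiE I B. F (x(i := s)))"
    by (rule sum.cartesian_product[symmetric])
  also have "\<dots> = (\<Sum>x \<in> PiE I B. \<Sum>s \<in> B i. F (x(i := s)))"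
    by (rule sum.swap)
  finally show ?thesis .
qed

lemma transfer_expectation_0:
  "transfer_expectation \<theta> p y a 0 h = (\<Sum>s\<in>UNIV. bernoulli_weight p s * h s)"
  using sum_PiE_insert[of a "{}" "\<lambda>x. bernoulli_weight p (x a) * h (x a)" "\<lambda>_. UNIV"]
  by (simp add: transfer_expectation_def)

lemma transfer_expectation_Suc:
  "transfer_expectation \<theta> p y a (Suc n) h =
    transfer_expectation \<theta> p y a n
      (\<lambda>s. \<Sum>t\<in>UNIV. bernoulli_weight p t * local_prob \<theta> s t (y (a + int n)) * h t)"
proof -
  let ?b = "a + int n"
  have ins: "{a..a + int (Suc n)} = insert (?b + 1) {a..?b}"
    "{a..<a + int (Suc n)} = insert ?b {a..<?b}" by auto
  have P: "(\<Prod>k\<in>insert (?b + 1) {a..?b}. bernoulli_weight p ((x(?b + 1 := t)) k)) =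
      bernoulli_weight p t * (\<Prod>k=a..?b. bernoulli_weight p (x k))" for x t
    by (subst prod.insert) (auto intro!: prod.cong)
  have Q: "(\<Prod>k\<in>insert ?b {a..<?b}.
        local_prob \<theta> ((x(?b + 1 := t)) k) ((x(?b + 1 := t)) (k + 1)) (y k)) =
      local_prob \<theta> (x ?b) t (y ?b) * (\<Prod>k=a..<?b. local_prob \<theta> (x k) (x (k + 1)) (y k))" for x t
    by (subst prod.insert) (auto intro!: prod.cong)
  have end_cell: "a + int (Suc n) = ?b + 1" by simp
  show ?thesis
    unfolding transfer_expectation_def ins P Q
    by (subst sum_PiE_insert, simp, unfold P Q end_cell)
       (simp add: sum_distrib_left algebra_simps)
qed

lemma measure_pca_step_word:
  assumes \<theta>: "\<And>x y. \<theta> x y \<in> {0..1}" and p: "p \<in> {0..1}"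
  shows "measure (pca_step \<theta> (bernoulli_product p)) (cylinder {a..<a + int n} y) =
    transfer_expectation \<theta> p y a n (\<lambda>_. 1)"
proof -
  have "{a..<a + int n} = {a..a + int n - 1}" by auto
  then show ?thesis
    using measure_pca_step_cylinder[of \<theta> "bernoulli_product p" a "a + int n - 1" y,
        OF \<theta> prob_space_bernoulli_product sets_bernoulli_product]
    by (simp add: transfer_expectation_def measure_bernoulli_product_cylinder[OF p])
qed

lemma prod_atLeastLessThan_int_Suc:
  "(\<Prod>k=a..<a + int (Suc n). f k) = (\<Prod>k=a..<a + int n. f k) * f (a + int n)"
proof -
  have "{a..<a + int (Suc n)} = insert (a + int n) {a..<a + int n}" by auto
  then show ?thesis by (simp add: mult.commute)
qed

section \<open>Sufficiency\<close>

text \<open>Here the transfer operator maps the constant function 1 to the constant \<open>w(y)\<close>.\<close>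

lemma transfer_expectation_right_average:
  assumes "\<And>s z. (\<Sum>t\<in>UNIV. bernoulli_weight p t * local_prob \<theta> s t z) = bernoulli_weight p z"
  shows "transfer_expectation \<theta> p y a n (\<lambda>_. c) = c * (\<Prod>k=a..<a + int n. bernoulli_weight p (y k))"
proof (induction n arbitrary: c)
  case 0
  show ?case by (simp add: transfer_expectation_0 UNIV_bool bernoulli_weight_def algebra_simps)
next
  case (Suc n)
  have "(\<Sum>t\<in>UNIV. bernoulli_weight p t * local_prob \<theta> s t z * c) = bernoulli_weight p z * c" for s z
    by (simp only: sum_distrib_right[symmetric] assms)
  then show ?case
    unfolding transfer_expectation_Suc prod_atLeastLessThan_int_Suc
    by (simp add: Suc.IH algebra_simps)
qed

text \<open>Here the word read so far is independent of the rightmost cell, whose law is \<open>w\<close>;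
  the arbitrary test function \<open>h\<close> expresses this independence.\<close>

lemma transfer_expectation_left_average:
  assumes "\<And>t z. (\<Sum>s\<in>UNIV. bernoulli_weight p s * local_prob \<theta> s t z) = bernoulli_weight p z"
  shows "transfer_expectation \<theta> p y a n h =
    (\<Prod>k=a..<a + int n. bernoulli_weight p (y k)) * (\<Sum>t\<in>UNIV. bernoulli_weight p t * h t)"
proof (induction n arbitrary: h)
  case 0
  show ?case by (simp add: transfer_expectation_0)
next
  case (Suc n)
  let ?z = "y (a + int n)"
  have "(\<Sum>s\<in>UNIV. bernoulli_weight p s *
        (\<Sum>t\<in>UNIV. bernoulli_weight p t * local_prob \<theta> s t ?z * h t)) =
      (\<Sum>t\<in>UNIV. (\<Sum>s\<in>UNIV. bernoulli_weight p s * local_prob \<theta> s t ?z) *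
        (bernoulli_weight p t * h t))"
    by (simp add: UNIV_bool algebra_simps)
  also have "\<dots> = bernoulli_weight p ?z * (\<Sum>t\<in>UNIV. bernoulli_weight p t * h t)"
    by (simp only: assms sum_distrib_left)
  finally show ?case
    unfolding transfer_expectation_Suc prod_atLeastLessThan_int_Suc Suc.IH
    by (simp add: algebra_simps)
qed

lemma pca_invariant_bernoulli_product:
  assumes \<theta>: "\<And>x y. \<theta> x y \<in> {0..1}" and p: "p \<in> {0..1}"
    and cond: "((1 - p) * \<theta> False False + p * \<theta> False True = p \<and>
        (1 - p) * \<theta> True False + p * \<theta> True True = p) \<or>
      ((1 - p) * \<theta> False False + p * \<theta> True False = p \<and>
        (1 - p) * \<theta> False True + p * \<theta> True True = p)"
  shows "pca_invariant \<theta> (bernoulli_product p)"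
proof -
  interpret \<mu>: prob_space "bernoulli_product p" by (rule prob_space_bernoulli_product)
  have K: "pca_kernel \<theta> \<in> bernoulli_product p \<rightarrow>\<^sub>M prob_algebra config_space"
    using pca_kernel_measurable sets_bernoulli_product by (simp cong: measurable_cong_sets)
  have M: "bernoulli_product p \<in> space (prob_algebra (bernoulli_product p))"
    by (simp add: space_prob_algebra \<mu>.prob_space_axioms)
  have step: "prob_space (pca_step \<theta> (bernoulli_product p))"
    unfolding pca_step_def by (rule prob_space_bind'[OF M K])
  have word: "transfer_expectation \<theta> p y a n (\<lambda>_. 1) =
      (\<Prod>k=a..<a + int n. bernoulli_weight p (y k))" for y a n
    using cond
  proof
    assume c: "(1 - p) * \<theta> False False + p * \<theta> False True = p \<and>
        (1 - p) * \<theta> True False + p * \<theta> True True = p"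
    have "(\<Sum>t\<in>UNIV. bernoulli_weight p t * local_prob \<theta> s t z) = bernoulli_weight p z" for s z
      using c by (cases s; cases z) (auto simp: UNIV_bool bernoulli_weight_def local_prob_def algebra_simps)
    from transfer_expectation_right_average[OF this] show ?thesis by simp
  next
    assume c: "(1 - p) * \<theta> False False + p * \<theta> True False = p \<and>
        (1 - p) * \<theta> False True + p * \<theta> True True = p"
    have "(\<Sum>s\<in>UNIV. bernoulli_weight p s * local_prob \<theta> s t z) = bernoulli_weight p z" for t z
      using c by (cases t; cases z) (auto simp: UNIV_bool bernoulli_weight_def local_prob_def algebra_simps)
    from transfer_expectation_left_average[OF this] show ?thesis
      by (simp add: UNIV_bool bernoulli_weight_def)
  qed
  have "measure (pca_step \<theta> (bernoulli_product p)) (cylinder {a..b} y) =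
      measure (bernoulli_product p) (cylinder {a..b} y)" for a b y
  proof -
    have "{a..b} = {a..<a + int (nat (b - a + 1))}" by auto
    then show ?thesis
      by (simp only: measure_pca_step_word[of \<theta> p, OF \<theta> p] word
          measure_bernoulli_product_cylinder[OF p] finite_atLeastLessThan_int)
  qed
  then show ?thesis
    unfolding pca_invariant_def
    by (intro measure_eqI_cylinders prob_space.finite_measure[OF step] \<mu>.finite_measure_axioms
        sets_bernoulli_product) (simp_all add: pca_step_def sets_bind'[OF M K])
qed

section \<open>Necessity\<close>

text \<open>On a two-point space every function is affine in the indicator of 1, so a covariance can only
  vanish because one of the two functions is constant.\<close>

lemma uncorrelated_two_point:
  fixes p :: real and f g :: "bool \<Rightarrow> real"
  assumes p: "0 < p" "p < 1"
    and f: "(1 - p) * f False + p * f True = m"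
    and g: "(1 - p) * g False + p * g True = m'"
    and fg: "(1 - p) * (f False * g False) + p * (f True * g True) = m * m'"
  shows "(f False = m \<and> f True = m) \<or> (g False = m' \<and> g True = m')"
proof -
  have "p * (1 - p) * ((f True - f False) * (g True - g False)) =
      (1 - p) * (f False * g False) + p * (f True * g True)
      - ((1 - p) * f False + p * f True) * ((1 - p) * g False + p * g True)"
    by (simp add: algebra_simps)
  also have "\<dots> = 0" by (simp add: f g fg)
  finally have "f True = f False \<or> g True = g False" using p by simp
  moreover have "(1 - p) * u + p * u = u" for u by (simp add: algebra_simps)
  ultimately show ?thesis using f g by metis
qed

lemma pca_invariant_bernoulli_productD:
  assumes \<theta>: "\<And>x y. \<theta> x y \<in> {0..1}" and p: "0 < p" "p < 1"
    and inv: "pca_invariant \<theta> (bernoulli_product p)"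
  shows "((1 - p) * \<theta> False False + p * \<theta> False True = p \<and>
        (1 - p) * \<theta> True False + p * \<theta> True True = p) \<or>
      ((1 - p) * \<theta> False False + p * \<theta> True False = p \<and>
        (1 - p) * \<theta> False True + p * \<theta> True True = p)"
proof -
  have p': "p \<in> {0..1}" using p by simp
  have word: "transfer_expectation \<theta> p (\<lambda>_. True) 0 n (\<lambda>_. 1) = p ^ n" for n
    using measure_pca_step_word[of \<theta> p, OF \<theta> p', of 0 n "\<lambda>_. True"]
      measure_bernoulli_product_cylinder[OF p', of "{0..<int n}" "\<lambda>_. True"] inv
    by (simp add: pca_invariant_def bernoulli_weight_def)
  define f where "f s = (1 - p) * \<theta> False s + p * \<theta> True s" for s
  define g where "g s = (1 - p) * \<theta> s False + p * \<theta> s True" for s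
  note expand = transfer_expectation_Suc transfer_expectation_0 UNIV_bool bernoulli_weight_def
    local_prob_def
  have 1: "(1 - p) * g False + p * g True = p"
    using word[of 1] by (simp add: expand g_def algebra_simps)
  have "(1 - p) * f False + p * f True = (1 - p) * g False + p * g True"
    by (simp add: f_def g_def algebra_simps)
  with 1 have 2: "(1 - p) * f False + p * f True = p" by simp
  \<comment> \<open>The middle one of three cells is the right parent of one new cell and the left parent of
    the next.\<close>
  have 3: "(1 - p) * (f False * g False) + p * (f True * g True) = p * p"
    using word[of "Suc (Suc 0)"] by (simp add: expand f_def g_def algebra_simps)
  show ?thesis
    using uncorrelated_two_point[OF p 2 1 3] by (auto simp: f_def g_def)
qed

section \<open>The algebraic condition\<close>

lemma parallel_of_common_ratio:
  fixes u1 u2 v1 v2 p :: real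
  assumes "p < 1" "(1 - p) * u1 = p * v1" "(1 - p) * u2 = p * v2"
  shows "u1 * v2 = u2 * v1"
proof -
  have "(1 - p) * (u1 * v2) = p * v1 * v2" using assms(2) by (simp add: mult.assoc[symmetric])
  also have "\<dots> = (1 - p) * (u2 * v1)" using assms(3) by (simp add: mult_ac)
  finally show ?thesis using assms(1) by simp
qed

lemma common_ratio_of_parallel:
  fixes u1 u2 v1 v2 :: real
  assumes nonneg: "0 \<le> u1" "0 \<le> u2" "0 \<le> v1" "0 \<le> v2" and par: "u1 * v2 = u2 * v1"
  obtains p where "0 \<le> p" "p \<le> 1" "(1 - p) * u1 = p * v1" "(1 - p) * u2 = p * v2"
    "(u1 = 0 \<and> u2 = 0 \<longleftrightarrow> v1 = 0 \<and> v2 = 0) \<Longrightarrow> 0 < p \<and> p < 1"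
proof -
  let ?U = "u1 + u2" and ?V = "v1 + v2"
  show thesis
  proof (cases "?U + ?V = 0")
    case True
    then show thesis using nonneg by (intro that[of "1/2"]) auto
  next
    case False
    then have pos: "?U + ?V > 0" using nonneg by linarith
    \<comment> \<open>Adding the two equations leaves no other choice for \<open>p\<close>.\<close>
    let ?p = "?U / (?U + ?V)"
    have q: "1 - ?p = ?V / (?U + ?V)" using False by (simp add: field_simps)
    have "?V * u1 = ?U * v1" "?V * u2 = ?U * v2" using par by (simp_all add: algebra_simps)
    then have "(1 - ?p) * u1 = ?p * v1" "(1 - ?p) * u2 = ?p * v2" unfolding q by simp_all
    moreover have "0 < ?p \<and> ?p < 1" if "u1 = 0 \<and> u2 = 0 \<longleftrightarrow> v1 = 0 \<and> v2 = 0"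
    proof -
      have "?U > 0" "?V > 0" using that nonneg pos by (auto simp: add_nonneg_eq_0_iff less_le)
      then show ?thesis by simp
    qed
    ultimately show thesis using nonneg pos by (intro that[of ?p]) auto
  qed
qed

theorem theorem3p2:
  fixes \<theta> :: "bool \<Rightarrow> bool \<Rightarrow> real"
  assumes "\<And>x y. 0 \<le> \<theta> x y \<and> \<theta> x y \<le> 1"
  shows
    "(\<forall>p. 0 < p \<and> p < 1 \<longrightarrow>
        (pca_invariant \<theta> (bernoulli_product p) \<longleftrightarrow>
          ((1 - p) * \<theta> False False + p * \<theta> False True = p \<and>
           (1 - p) * \<theta> True False + p * \<theta> True True = p) \<or>
          ((1 - p) * \<theta> False False + p * \<theta> True False = p \<and>
           (1 - p) * \<theta> False True + p * \<theta> True True = p)))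
     \<and> (\<not> degenerate \<theta> \<longrightarrow>
        ((\<exists>p. 0 < p \<and> p < 1 \<and> pca_invariant \<theta> (bernoulli_product p)) \<longleftrightarrow>
          \<theta> False False * (1 - \<theta> True True) = \<theta> True False * (1 - \<theta> False True) \<or>
          \<theta> False False * (1 - \<theta> True True) = \<theta> False True * (1 - \<theta> True False)))
     \<and> ((\<exists>p. 0 < p \<and> p < 1 \<and> pca_invariant \<theta> (bernoulli_product p)) \<longrightarrow>
          \<theta> False False * (1 - \<theta> True True) = \<theta> True False * (1 - \<theta> False True) \<or>
          \<theta> False False * (1 - \<theta> True True) = \<theta> False True * (1 - \<theta> True False))
     \<and> (\<theta> False False * (1 - \<theta> True True) = \<theta> True False * (1 - \<theta> False True) \<or>
        \<theta> False False * (1 - \<theta> True True) = \<theta> False True * (1 - \<theta> True False) \<longrightarrow>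
          (\<exists>p. 0 \<le> p \<and> p \<le> 1 \<and> pca_invariant \<theta> (bernoulli_product p)))"
proof -
  let ?a = "\<theta> False False" and ?b = "\<theta> False True" and ?c = "\<theta> True False" and ?d = "\<theta> True True"
  let ?R = "\<lambda>p. (1 - p) * ?a + p * ?b = p \<and> (1 - p) * ?c + p * ?d = p"
  let ?L = "\<lambda>p. (1 - p) * ?a + p * ?c = p \<and> (1 - p) * ?b + p * ?d = p"
  let ?inv = "\<lambda>p. pca_invariant \<theta> (bernoulli_product p)"
  let ?alg = "?a * (1 - ?d) = ?c * (1 - ?b) \<or> ?a * (1 - ?d) = ?b * (1 - ?c)"
  have \<theta>: "\<theta> x y \<in> {0..1}" for x y using assms by simp
  have bounds: "0 \<le> \<theta> x y" "0 \<le> 1 - \<theta> x y" for x y using assms by simp_all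
  have suff: "?inv p" if "0 \<le> p" "p \<le> 1" "?R p \<or> ?L p" for p
    using that by (intro pca_invariant_bernoulli_product[of \<theta>, OF \<theta>]) auto
  have char: "?inv p \<longleftrightarrow> ?R p \<or> ?L p" if "0 < p" "p < 1" for p
    using suff[of p] pca_invariant_bernoulli_productD[of \<theta> p, OF \<theta> that] that by auto
  have R_iff: "?R p \<longleftrightarrow> (1 - p) * ?a = p * (1 - ?b) \<and> (1 - p) * ?c = p * (1 - ?d)" for p
    by (auto simp: algebra_simps)
  have L_iff: "?L p \<longleftrightarrow> (1 - p) * ?a = p * (1 - ?c) \<and> (1 - p) * ?b = p * (1 - ?d)" for p
    by (auto simp: algebra_simps)
  have alg: ?alg if p: "0 < p" "p < 1" and "?inv p" for p
  proof -
    have "?R p \<or> ?L p" using char[OF p] that by simp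
    then show ?thesis
      unfolding R_iff L_iff using parallel_of_common_ratio[OF p(2)] by blast
  qed
  have ex: "\<exists>p. 0 \<le> p \<and> p \<le> 1 \<and> (?R p \<or> ?L p) \<and> (\<not> degenerate \<theta> \<longrightarrow> 0 < p \<and> p < 1)" if ?alg
    using that
  proof
    assume "?a * (1 - ?d) = ?c * (1 - ?b)"
    from common_ratio_of_parallel[OF bounds(1) bounds(1) bounds(2) bounds(2) this]
    obtain p where "0 \<le> p" "p \<le> 1" "?R p"
      "?a = 0 \<and> ?c = 0 \<longleftrightarrow> 1 - ?b = 0 \<and> 1 - ?d = 0 \<Longrightarrow> 0 < p \<and> p < 1"
      unfolding R_iff by blast
    then show ?thesis unfolding degenerate_def by (intro exI[of _ p]) auto
  next
    assume "?a * (1 - ?d) = ?b * (1 - ?c)"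
    from common_ratio_of_parallel[OF bounds(1) bounds(1) bounds(2) bounds(2) this]
    obtain p where "0 \<le> p" "p \<le> 1" "?L p"
      "?a = 0 \<and> ?b = 0 \<longleftrightarrow> 1 - ?c = 0 \<and> 1 - ?d = 0 \<Longrightarrow> 0 < p \<and> p < 1"
      unfolding L_iff by blast
    then show ?thesis unfolding degenerate_def by (intro exI[of _ p]) auto
  qed
  have 1: "\<forall>p. 0 < p \<and> p < 1 \<longrightarrow> (?inv p \<longleftrightarrow> ?R p \<or> ?L p)" using char by blast
  have 3: "(\<exists>p. 0 < p \<and> p < 1 \<and> ?inv p) \<longrightarrow> ?alg" using alg by blast
  have 2: "\<not> degenerate \<theta> \<longrightarrow> ((\<exists>p. 0 < p \<and> p < 1 \<and> ?inv p) \<longleftrightarrow> ?alg)"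
    using 3 ex suff by meson
  have 4: "?alg \<longrightarrow> (\<exists>p. 0 \<le> p \<and> p \<le> 1 \<and> ?inv p)"
    using ex suff by meson
  show ?thesis using 1 2 3 4 by (intro conjI)
qed

end
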